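(* Let $n\ge 3$ and let $A$ be the $n$-by-$n$ reciprocal matrix whose first row is $(1,a_{12},\dots,a_{1n})$ with $a_{1k}>0$, whose first column is $(1,1/a_{12},\dots,1/a_{1n})^T$, and all of whose other entries equal $1$, and suppose $A$ is not consistent. Then $$\mathcal{E}(A)=\bigcup_{(i,j)\in\mathcal{N}}\varepsilon_{ij}(A),\qquad \mathcal{N}=\{(i,j): i,j\in\{2,\dots,n\},\ a_{1i}a_{j1}<1\},$$ where $\varepsilon_{ij}(A)=\{w\in\mathbb{R}^n_+: a_{i1}w_1\ge w_i\ge w_k\ge w_j\ge a_{j1}w_1 \text{ for all } k\ne 1,i,j\}$.
   Context: An $n$-by-$n$ matrix $A=[a_{ij}]$ is reciprocal if all its entries are positive and $a_{ji}=1/a_{ij}$ (so $a_{k1}=1/a_{1k}$); it is consistent if $A=[w_p/w_q]$ for some entry-wise positive $w$. $\mathbb{R}^n_+$ is the set of entry-wise positive vectors. A vector $w\in\mathbb{R}^n_+$ is efficient for $A$ if, for $v\in\mathbb{R}^n_+$, $|a_{pq}-v_p/v_q|\le|a_{pq}-w_p/w_q|$ for all $p,q$ implies $v$ is a positive multiple of $w$; $\mathcal{E}(A)$ is the set of efficient vectors. *)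

theory Defs
  imports Complex_Main "Jordan_Normal_Form.Matrix"
begin

text \<open>
  Rows, columns and vector entries are numbered from 0, so the mathematical index \<open>k\<close>
  (with \<open>1 \<le> k \<le> n\<close>) corresponds to \<open>k - 1\<close> here; in particular the first
  row and column have index 0.
\<close>

definition pos_vecs :: "nat \<Rightarrow> real vec set" where
  "pos_vecs n = {w \<in> carrier_vec n. \<forall>i<n. 0 < w $ i}"

text \<open>The diagonal entries of a reciprocal matrix are 1 (take \<open>i = j\<close>).\<close>

definition reciprocal_mat :: "real mat \<Rightarrow> bool" where
  "reciprocal_mat A \<longleftrightarrow> square_mat A \<and>
     (\<forall>i<dim_row A. \<forall>j<dim_row A. 0 < A $$ (i, j) \<and> A $$ (j, i) = 1 / A $$ (i, j))"

definition consistent_mat :: "real mat \<Rightarrow> bool" where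
  "consistent_mat A \<longleftrightarrow>
     (\<exists>w\<in>pos_vecs (dim_row A). A = mat (dim_row A) (dim_row A) (\<lambda>(p, q). w $ p / w $ q))"

definition efficient :: "real mat \<Rightarrow> real vec \<Rightarrow> bool" where
  "efficient A w \<longleftrightarrow> w \<in> pos_vecs (dim_row A) \<and>
     (\<forall>v\<in>pos_vecs (dim_row A).
        (\<forall>p<dim_row A. \<forall>q<dim_row A.
           \<bar>A $$ (p, q) - v $ p / v $ q\<bar> \<le> \<bar>A $$ (p, q) - w $ p / w $ q\<bar>)
        \<longrightarrow> (\<exists>c>0. v = c \<cdot>\<^sub>v w))"

definition efficient_vecs :: "real mat \<Rightarrow> real vec set" where
  "efficient_vecs A = {w. efficient A w}"

text \<open>
  The chain \<open>a\<^sub>i\<^sub>1 w\<^sub>1 \<ge> w\<^sub>i \<ge> w\<^sub>k \<ge> w\<^sub>j \<ge> a\<^sub>j\<^sub>1 w\<^sub>1\<close> for all \<open>k\<close> different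
  from \<open>1, i, j\<close>. The inequalities not involving \<open>k\<close> are stated separately because there is
  no such \<open>k\<close> when \<open>n = 3\<close> and \<open>i \<noteq> j\<close>, where the chain means
  \<open>a\<^sub>i\<^sub>1 w\<^sub>1 \<ge> w\<^sub>i \<ge> w\<^sub>j \<ge> a\<^sub>j\<^sub>1 w\<^sub>1\<close>; as soon as some \<open>k\<close> exists, \<open>w\<^sub>i \<ge> w\<^sub>j\<close> is redundant.
\<close>

definition eps_set :: "real mat \<Rightarrow> nat \<Rightarrow> nat \<Rightarrow> real vec set" where
  "eps_set A i j = {w \<in> pos_vecs (dim_row A).
     A $$ (i, 0) * w $ 0 \<ge> w $ i \<and> w $ i \<ge> w $ j \<and> w $ j \<ge> A $$ (j, 0) * w $ 0 \<and>
     (\<forall>k<dim_row A. k \<noteq> 0 \<and> k \<noteq> i \<and> k \<noteq> j \<longrightarrow> w $ i \<ge> w $ k \<and> w $ k \<ge> w $ j)}"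

definition N_pairs :: "real mat \<Rightarrow> (nat \<times> nat) set" where
  "N_pairs A = {(i, j). i \<in> {1..<dim_row A} \<and> j \<in> {1..<dim_row A} \<and>
                        A $$ (0, i) * A $$ (j, 0) < 1}"

end

theory Submission
  imports Defs
begin

text \<open>
  Draw an edge from \<open>p\<close> to \<open>q\<close> when \<open>w\<^sub>p / w\<^sub>q \<ge> a\<^sub>p\<^sub>q\<close>. If no edge leaves a nonempty proper set
  \<open>S\<close> of indices, then shrinking \<open>w\<close> slightly on \<open>S\<close> improves it, so an efficient vector has an
  edge across every cut; conversely, \<open>v\<^sub>p / w\<^sub>p\<close> increases weakly along edges whenever \<open>v\<close> is
  at least as good as \<open>w\<close>, so a strongly connected graph forces efficiency. For the matrix at
  hand the indices other than the first are ordered by their weight, so strong connectivity means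
  that some index of least weight has an edge to the first index, which has an edge to some index
  of greatest weight. These two are \<open>j\<close> and \<open>i\<close>; if they give \<open>a\<^sub>1\<^sub>i a\<^sub>j\<^sub>1 = 1\<close>, then all weights but the first
  are equal, and inconsistency provides another index to replace one of them.
\<close>

lemma efficient_edge_across_cut:
  assumes rec: "reciprocal_mat A" and eff: "efficient A w"
    and S: "S \<subseteq> {..<dim_row A}" "S \<noteq> {}" "S \<noteq> {..<dim_row A}"
  obtains p q where "p \<in> S" "q < dim_row A" "q \<notin> S" "w $ p / w $ q \<le> A $$ (p, q)"
proof (rule ccontr)
  note edge = that
  assume "\<not> thesis"
  let ?n = "dim_row A" and ?T = "{..<dim_row A} - S"
  \<comment> \<open>If the claim fails, no edge enters \<open>S\<close> from outside: every ratio
    from \<open>S\<close> to its complement is strictly too large.\<close>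
  have cut: "A $$ (p, q) < w $ p / w $ q" if "p \<in> S" "q \<in> ?T" for p q
    using that \<open>\<not> thesis\<close> edge[of p q] by (auto simp: not_less[symmetric])
  have w: "w \<in> carrier_vec ?n" and wpos: "\<And>p. p < ?n \<Longrightarrow> 0 < w $ p"
    using eff by (auto simp: efficient_def pos_vecs_def)
  have Apos: "\<And>p q. p < ?n \<Longrightarrow> q < ?n \<Longrightarrow> 0 < A $$ (p, q)"
    and Arec: "\<And>p q. p < ?n \<Longrightarrow> q < ?n \<Longrightarrow> A $$ (q, p) = 1 / A $$ (p, q)"
    using rec unfolding reciprocal_mat_def by blast+
  \<comment> \<open>The maximum \<open>t\<close> of these finitely many quotients is the least
    factor by which \<open>w\<close> can be multiplied on \<open>S\<close> without any ratio across
    the cut dropping below its entry of \<open>A\<close>. The strict inequalities give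
    \<open>t < 1\<close>.\<close>
  define R where "R = (\<lambda>(p, q). A $$ (p, q) * w $ q / w $ p) ` (S \<times> ?T)"
  define t where "t = Max R"
  obtain p0 q0 where p0: "p0 \<in> S" and q0: "q0 \<in> ?T" using S by blast
  have "finite S" using S(1) finite_subset by blast
  then have R: "finite R" "R \<noteq> {}" using p0 q0 by (auto simp: R_def)
  have R01: "0 < r \<and> r < 1" if "r \<in> R" for r
  proof -
    obtain p q where pq: "p \<in> S" "q \<in> ?T" and r: "r = A $$ (p, q) * w $ q / w $ p"
      using \<open>r \<in> R\<close> by (auto simp: R_def)
    then have "0 < w $ p" "0 < w $ q" "0 < A $$ (p, q)" using S(1) wpos Apos by auto
    then show ?thesis using cut[OF pq] by (simp add: r field_simps)
  qed
  have t: "0 < t" "t < 1" using R01 Max_in[OF R] by (auto simp: t_def)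
  have t_ge: "A $$ (p, q) \<le> t * w $ p / w $ q" if "p \<in> S" "q \<in> ?T" for p q
  proof -
    have "A $$ (p, q) * w $ q / w $ p \<le> t"
      unfolding t_def using R(1) that by (intro Max_ge) (auto simp: R_def)
    then show ?thesis using that S(1) wpos[of p] wpos[of q] by (auto simp: field_simps)
  qed
  define v where "v = vec ?n (\<lambda>k. if k \<in> S then t * w $ k else w $ k)"
  have v_pos: "v \<in> pos_vecs ?n" using wpos t by (auto simp: v_def pos_vecs_def)
  have "\<bar>A $$ (p, q) - v $ p / v $ q\<bar> \<le> \<bar>A $$ (p, q) - w $ p / w $ q\<bar>"
    if pq: "p < ?n" "q < ?n" for p q
  proof -
    note pos = wpos[OF pq(1)] wpos[OF pq(2)] Apos[OF pq] t
    consider "p \<in> S \<longleftrightarrow> q \<in> S" | "p \<in> S" "q \<notin> S" | "p \<notin> S" "q \<in> S" by blast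
    then show ?thesis
    proof cases
      case 1
      then have "v $ p / v $ q = w $ p / w $ q" using pq pos by (auto simp: v_def)
      then show ?thesis by simp
    next
      case 2
      have "t * w $ p / w $ q \<le> w $ p / w $ q"
        using pos by (simp add: field_simps)
      then show ?thesis using t_ge[of p q] 2 pq by (auto simp: v_def)
    next
      case 3
      \<comment> \<open>Ratios from the complement into \<open>S\<close> grow instead; by
        reciprocity the bound for \<open>(q, p)\<close> keeps them from passing
        \<open>A $$ (p, q)\<close>.\<close>
      have "A $$ (q, p) \<le> t * w $ q / w $ p" using t_ge[of q p] 3 pq by auto
      then have "w $ p / (t * w $ q) \<le> A $$ (p, q)"
        using pos Arec[OF pq] by (simp add: field_simps)
      moreover have "w $ p / w $ q \<le> w $ p / (t * w $ q)"
        using pos by (simp add: field_simps)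
      ultimately show ?thesis using 3 pq by (auto simp: v_def)
    qed
  qed
  then obtain c where "v = c \<cdot>\<^sub>v w"
    using eff v_pos unfolding efficient_def by blast
  \<comment> \<open>The scaling factor would have to be \<open>t\<close> inside \<open>S\<close> and
    1 outside.\<close>
  then have "v $ p0 = c * w $ p0" "v $ q0 = c * w $ q0" using w p0 q0 S(1) by auto
  then have "t = c" "c = 1"
    using p0 q0 S(1) wpos[of p0] wpos[of q0] by (auto simp: v_def subset_iff)
  then show False using t by simp
qed

text \<open>Moving a ratio that is already at least \<open>a\<close> further up takes it further
  from \<open>a\<close>, so along an edge \<open>v\<close> can only keep or lower the ratio of
  \<open>w\<close>.\<close>

lemma ratio_le_along_edge:
  fixes v w :: "real vec"
  assumes "0 < v $ p" "0 < v $ q" "0 < w $ p" "0 < w $ q"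
    and "a \<le> w $ p / w $ q" "\<bar>a - v $ p / v $ q\<bar> \<le> \<bar>a - w $ p / w $ q\<bar>"
  shows "v $ p / w $ p \<le> v $ q / w $ q"
proof -
  have "v $ p / v $ q \<le> w $ p / w $ q" using assms(5,6) by linarith
  then show ?thesis using assms(1-4) by (simp add: field_simps)
qed

theorem theorem18:
  fixes A :: "real mat" and n :: nat
  assumes "n \<ge> 3"
    and "A \<in> carrier_mat n n"
    and "reciprocal_mat A"
    and "\<And>i j. i \<in> {1..<n} \<Longrightarrow> j \<in> {1..<n} \<Longrightarrow> A $$ (i, j) = 1"
    and "\<not> consistent_mat A"
  shows "efficient_vecs A = (\<Union>(i, j)\<in>N_pairs A. eps_set A i j)"
proof -
  have dim: "dim_row A = n" "dim_col A = n" using assms(2) by auto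
  let ?K = "{1..<n}"
  define b where "b k = A $$ (k, 0)" for k
  have Arec: "0 < A $$ (p, q)" "A $$ (q, p) = 1 / A $$ (p, q)" if "p < n" "q < n" for p q
    using assms(3) that unfolding reciprocal_mat_def dim by blast+
  have bpos: "0 < b k" and row0: "A $$ (0, k) = 1 / b k" if "k < n" for k
    using Arec[of k 0] assms(1) that by (auto simp: b_def)
  have A00: "A $$ (0, 0) = 1"
  proof -
    have pos: "0 < A $$ (0, 0)" using Arec(1)[of 0 0] assms(1) by simp
    have "A $$ (0, 0) = 1 / A $$ (0, 0)" using Arec(2)[of 0 0] assms(1) by linarith
    then have "A $$ (0, 0) * A $$ (0, 0) = 1"
      by (metis pos less_irrefl nonzero_eq_divide_eq)
    then show ?thesis using square_eq_1_iff[of "A $$ (0, 0)"] pos by auto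
  qed
  \<comment> \<open>Since \<open>A $$ (0, i)\<close> is the inverse of \<open>b i\<close>, the
    condition on the product compares two entries of the first column.\<close>
  have N: "(i, j) \<in> N_pairs A \<longleftrightarrow> i \<in> ?K \<and> j \<in> ?K \<and> b j < b i" for i j
    using row0[of i] bpos[of i] by (auto simp: N_pairs_def dim b_def[symmetric])
  show ?thesis
  proof (intro subset_antisym subsetI)
    fix w assume "w \<in> efficient_vecs A"
    then have eff: "efficient A w" by (simp add: efficient_vecs_def)
    then have w_pos: "w \<in> pos_vecs n" and wpos: "\<And>p. p < n \<Longrightarrow> 0 < w $ p"
      by (auto simp: efficient_def pos_vecs_def dim)
    have w0: "0 < w $ 0" using wpos assms(1) by simp
    let ?top = "{k\<in>?K. \<forall>l\<in>?K. w $ l \<le> w $ k}"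
    let ?bot = "{k\<in>?K. \<forall>l\<in>?K. w $ k \<le> w $ l}"
    let ?W = "(\<lambda>k. w $ k) ` ?K"
    have W: "finite ?W" "?W \<noteq> {}" using assms(1) by auto
    obtain m where "m \<in> ?K" "Max ?W = w $ m" using Max_in[OF W] by blast
    then have "w $ k \<le> w $ m" if "k \<in> ?K" for k using Max_ge[OF W(1) imageI[OF that]] by simp
    then have "m \<in> ?top" using \<open>m \<in> ?K\<close> by blast
    then have "?top \<noteq> {}" by blast
    moreover have "?top \<subseteq> {..<n}" by auto
    moreover have "?top \<noteq> {..<n}" using assms(1) by force
    ultimately obtain i q where i: "i \<in> ?top" and q: "q < n" "q \<notin> ?top"
      and iq: "w $ i / w $ q \<le> A $$ (i, q)"
      using efficient_edge_across_cut[OF assms(3) eff, of ?top] unfolding dim by blast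
    \<comment> \<open>The entry \<open>A $$ (i, q)\<close> is 1 for any other \<open>q\<close>, so
      \<open>q\<close> would have weight at least the maximum and lie in \<open>?top\<close> itself.
      Cutting off all maximal indices at once is what excludes this.\<close>
    have "q = 0"
    proof (rule ccontr)
      assume "q \<noteq> 0"
      then have "w $ i \<le> w $ q"
        using iq i q(1) assms(4)[of i q] wpos[of q] by (auto simp: field_simps)
      then show False using i q \<open>q \<noteq> 0\<close> by force
    qed
    then have i0: "w $ i \<le> b i * w $ 0" using iq w0 by (simp add: b_def field_simps)
    \<comment> \<open>An edge into the complement of \<open>?bot\<close> is an edge out of
      \<open>?bot\<close>, and as before it can only meet the first index.\<close>
    let ?S = "{..<n} - ?bot"
    obtain l where l: "l \<in> ?K" "Min ?W = w $ l" using Min_in[OF W] by blast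
    then have "w $ l \<le> w $ k" if "k \<in> ?K" for k using Min_le[OF W(1) imageI[OF that]] by simp
    then have "l \<in> ?bot" using l(1) by blast
    moreover have "l \<in> {..<n}" using l(1) by simp
    ultimately have "?S \<noteq> {..<n}" by blast
    moreover have "0 \<in> ?S" using assms(1) by simp
    then have "?S \<noteq> {}" by blast
    moreover have "?S \<subseteq> {..<n}" by blast
    ultimately obtain p j where p: "p \<in> ?S" and j: "j < n" "j \<notin> ?S"
      and pj: "w $ p / w $ j \<le> A $$ (p, j)"
      using efficient_edge_across_cut[OF assms(3) eff, of ?S] unfolding dim by blast
    have jbot: "j \<in> ?bot" using j by auto
    have "p = 0"
    proof (rule ccontr)
      assume "p \<noteq> 0"
      then have "w $ p \<le> w $ j"
        using pj p jbot assms(4)[of p j] wpos[of j] by (auto simp: field_simps)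
      then show False using p jbot \<open>p \<noteq> 0\<close> by force
    qed
    then have j0: "b j * w $ 0 \<le> w $ j"
      using pj row0[of j] bpos[of j] wpos[of j] j(1) by (simp add: field_simps)
    have "\<exists>i j. i \<in> ?top \<and> j \<in> ?bot \<and> w $ i \<le> b i * w $ 0 \<and> b j * w $ 0 \<le> w $ j \<and> b j < b i"
    proof (cases "b j < b i")
      case True
      then show ?thesis using i jbot i0 j0 by blast
    next
      case False
      then have "b i * w $ 0 \<le> b j * w $ 0" using w0 by simp
      moreover have "w $ j \<le> w $ i" using i jbot by auto
      \<comment> \<open>The chain \<open>b i * w $ 0 \<le> b j * w $ 0 \<le> w $ j \<le> w $ i \<le>
        b i * w $ 0\<close> closes up, so equality holds throughout.\<close>
      ultimately have eq: "w $ i = b i * w $ 0" "w $ j = w $ i" "b j * w $ 0 = b i * w $ 0"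
        using i0 j0 by linarith+
      have bij: "b j = b i" using eq(3) w0 by simp
      have const: "w $ k = b i * w $ 0" if "k \<in> ?K" for k
        using that i jbot eq by (auto intro: antisym)
      \<comment> \<open>Otherwise \<open>w\<close> itself would witness that \<open>A\<close> is
        consistent.\<close>
      have "\<exists>k\<in>?K. b k \<noteq> b i"
      proof (rule ccontr)
        assume "\<not> (\<exists>k\<in>?K. b k \<noteq> b i)"
        then have wb: "w $ k = b k * w $ 0" if "k \<in> ?K" for k using const that by simp
        have "A $$ (p, q) = w $ p / w $ q" if "p < n" "q < n" for p q
        proof (cases "p = 0 \<or> q = 0")
          case True
          then show ?thesis
            using that w0 wb[of p] wb[of q] row0[of q] A00 by (cases "p = 0"; cases "q = 0") (auto simp: b_def)
        next
          case False
          then show ?thesis using that assms(4)[of p q] const[of p] const[of q] wpos[of q] by auto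
        qed
        then have "A = mat n n (\<lambda>(p, q). w $ p / w $ q)" using dim by (intro eq_matI) auto
        then show False using assms(5) w_pos dim by (auto simp: consistent_mat_def)
      qed
      then obtain k where k: "k \<in> ?K" "b k \<noteq> b i" by blast
      \<comment> \<open>All weights but the first agree, so \<open>k\<close> is both maximal and
        minimal: it can replace \<open>j\<close> if \<open>b k < b i\<close>, and \<open>i\<close>
        if \<open>b k\<close> is larger.\<close>
      have k_all: "k \<in> ?top" "k \<in> ?bot" using k(1) const by auto
      show ?thesis
      proof (cases "b k < b i")
        case True
        then have "b k * w $ 0 \<le> w $ k" using const[OF k(1)] w0 by simp
        then show ?thesis using True i i0 k_all by blast
      next
        case False
        then have lt: "b j < b k" using k(2) bij by simp
        then have "w $ k \<le> b k * w $ 0" using const[OF k(1)] bij w0 by simp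
        then show ?thesis using lt jbot j0 k_all by blast
      qed
    qed
    then obtain i j where ij: "i \<in> ?top" "j \<in> ?bot" "w $ i \<le> b i * w $ 0" "b j * w $ 0 \<le> w $ j"
      "b j < b i" by blast
    then have "(i, j) \<in> N_pairs A" "w \<in> eps_set A i j"
      using w_pos by (auto simp: N eps_set_def dim b_def[symmetric])
    then show "w \<in> (\<Union>(i, j)\<in>N_pairs A. eps_set A i j)" by blast
  next
    fix w assume "w \<in> (\<Union>(i, j)\<in>N_pairs A. eps_set A i j)"
    then obtain i j where ij: "i \<in> ?K" "j \<in> ?K" and weps: "w \<in> eps_set A i j"
      using N by blast
    then have w_pos: "w \<in> pos_vecs n" and w: "w \<in> carrier_vec n"
      and wpos: "\<And>p. p < n \<Longrightarrow> 0 < w $ p"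
      and i0: "w $ i \<le> b i * w $ 0" and j0: "b j * w $ 0 \<le> w $ j" and ij_le: "w $ j \<le> w $ i"
      and k_le: "\<And>k. k \<in> ?K \<Longrightarrow> w $ k \<le> w $ i \<and> w $ j \<le> w $ k"
      by (auto simp: eps_set_def pos_vecs_def dim b_def)
    have w0: "0 < w $ 0" using wpos assms(1) by simp
    have "\<exists>c>0. v = c \<cdot>\<^sub>v w"
      if v: "v \<in> pos_vecs n" and better: "\<And>p q. p < n \<Longrightarrow> q < n \<Longrightarrow>
        \<bar>A $$ (p, q) - v $ p / v $ q\<bar> \<le> \<bar>A $$ (p, q) - w $ p / w $ q\<bar>" for v
    proof -
      have vpos: "\<And>p. p < n \<Longrightarrow> 0 < v $ p" and vc: "v \<in> carrier_vec n"
        using v by (auto simp: pos_vecs_def)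
      define u where "u p = v $ p / w $ p" for p
      have edge: "u p \<le> u q" if "p < n" "q < n" "A $$ (p, q) \<le> w $ p / w $ q" for p q
        unfolding u_def using that better by (intro ratio_le_along_edge vpos wpos)
      have edgeK: "u p \<le> u q" if "p \<in> ?K" "q \<in> ?K" "w $ q \<le> w $ p" for p q
        using that edge[of p q] assms(4)[of p q] wpos[of q] by auto
      \<comment> \<open>For each \<open>k\<close>, the indices 0, \<open>i\<close>,
        \<open>k\<close>, \<open>j\<close>, 0 form a closed walk along edges. As \<open>u\<close>
        cannot decrease on it, \<open>u\<close> is constant, which makes \<open>v\<close> a multiple
        of \<open>w\<close>.\<close>
      have "u 0 \<le> u i"
        using edge[of 0 i] ij i0 row0[of i] bpos[of i] wpos[of i] by (auto simp: field_simps)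
      moreover have "u j \<le> u 0"
        using edge[of j 0] ij j0 w0 by (auto simp: b_def field_simps)
      moreover have "u i \<le> u k" "u k \<le> u j" if "k \<in> ?K" for k
        using edgeK ij k_le that by auto
      ultimately have "u k = u 0" if "k \<in> ?K" for k
        using that ij by (meson antisym order_trans)
      then have u_eq: "u k = u 0" if "k < n" for k
        using that by (cases "k = 0") auto
      have "v = u 0 \<cdot>\<^sub>v w"
      proof (rule eq_vecI)
        fix k assume "k < dim_vec (u 0 \<cdot>\<^sub>v w)"
        then have k: "k < n" using w by auto
        show "v $ k = (u 0 \<cdot>\<^sub>v w) $ k"
          using u_eq[OF k] wpos[OF k] k w by (simp add: u_def[of k] field_simps)
      qed (use w vc in auto)
      moreover have "0 < u 0" using vpos[of 0] w0 assms(1) by (simp add: u_def)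
      ultimately show ?thesis by blast
    qed
    then show "w \<in> efficient_vecs A"
      using w_pos by (auto simp: efficient_vecs_def efficient_def dim)
  qed
qed

end
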